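(* Let $s\ge1$ be an integer, $p,q\in\mathbb{C}$, $h\in\mathbb{C}\setminus\{0\}$, and let $n\ge1$ be an integer. In the $(p,q)$-deformed generalized Weyl algebra $A_{s;h|p,q}$ one has $$(YX)^n=\sum_{\ell=0}^{n}\mathscr{R}_{s,h;p,q}[J_n,n-\ell]\;Y^{s(n-\ell)+\ell}Z_p^{n-\ell}X^{\ell},$$ and the $(p,q)$-deformed generalized Stirling numbers satisfy $\mathfrak{S}_{s;h}(n,\ell|p,q)=\mathscr{R}_{s,h;p,q}[J_n,n-\ell]$ for $0\le\ell\le n$.
   Context: The algebra $A_{s;h|p,q}$ is the complex unital algebra generated by $X,Y,Z_p$ subject to $XY-qYX=hY^sZ_p$, $Z_pY=pYZ_p$, $XZ_p=pZ_pX$, with the convention $Z_1=I$ (i.e. for $p=1$ the element $Z_p$ is the identity). Twin-basic numbers: $[k]_{p,q}=\frac{p^k-q^k}{p-q}=p^{k-1}+p^{k-2}q+\cdots+q^{k-1}$ for $k\ge 1$, $[0]_{p,q}=0$. The generalized Stirling numbers $\mathfrak{S}_{s;h}(n,k|p,q)$ are the coefficients in the normal ordering expansion $(YX)^n=\sum_{k=0}^n\mathfrak{S}_{s;h}(n,k|p,q)\,Y^{s(n-k)+k}Z_p^{n-k}X^k$; they are uniquely determined by $\mathfrak{S}_{s;h}(0,0|p,q)=1$, $\mathfrak{S}_{s;h}(n,k|p,q)=0$ for $k<0$ or $k>n$, and, for $n\ge0$, $0\le k\le n+1$, $$\mathfrak{S}_{s;h}(n+1,k|p,q)=p^{n-k+1}q^{s(n-k+1)+k-1}\mathfrak{S}_{s;h}(n,k-1|p,q)+h[s(n-k)+k]_{p,q}\mathfrak{S}_{s;h}(n,k|p,q)$$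 (terms containing a vanishing $\mathfrak{S}_{s;h}$ are read as $0$). A Ferrers board is a top-justified arrangement of columns of boxes whose heights weakly decrease from left to right. The staircase board $J_n$ is the Ferrers board with columns of heights $n-1,n-2,\dots,2,1$ from left to right. $s$-rook placements. For $s\ge1$, $\mathcal{R}_s(B,k)$ denotes the set of placements of $k$ rooks on $B$ satisfying the $s$-row creation rule: rooks are placed going from right to left, at most one in each column; whenever a rook is placed in a box, $s$ new rows are inserted in all columns to the left of the rook, immediately beneath the row of the rook (the rook's own row also continues to the left, directly above the $s$ new rows); later rooks may be placed in the new rows, but not in the row of an earlier rook (non-attacking). Thus if $b$ rooks have been placed to the right of a column of original height $c$, that column has $c+sb$ boxes, $b$ of which lie in rows of earlier rooks and are forbidden. Weights. Given $\phi\in\mathcal{R}_s(B,k)$, the boxes of the enlarged board (including all created boxes) are divided into: rook boxes (occupied by a rook); $t$-boxes: non-rook boxes lying above a rook (in its column) and not lying to the left of another rook (in its row); $\ell$-boxes: non-rook boxes lying to the left of a rook (in its row) and not lying in the column of another rook; cancelled boxes: non-rook boxes lying to the left of a rook and in the column of another rook; $e$-boxes: all remaining boxes. The weight is $\omega_{s;p,q}(B;\phi)=h^kp^{\#t\text{-boxes}+\#\ell\text{-boxes}}q^{\#e\text{-boxes}}$, and $\mathscr{R}_{s,h;p,q}[B,k]=\sum_{\phi\in\mathcal{R}_s(B,k)}\omega_{s;p,q}(B;\phi)$ (equal to $0$ if there are no such placements). *)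

theory Defs
  imports
    Complex_Main
    "HOL-Library.Poly_Mapping"
    "HOL-Algebra.QuotRing"
begin

section \<open>The free algebra\<close>

text \<open>
  Words over an alphabet, written additively (\<open>+\<close> is concatenation, \<open>0\<close> the empty word), so that
  the convolution product of \<^theory>\<open>HOL-Library.Poly_Mapping\<close> turns the finitely supported
  functions from words to complex numbers into the free complex unital algebra.
\<close>

datatype 'a free_word = Word "'a list"

instantiation free_word :: (type) monoid_add
begin

definition zero_free_word :: "'a free_word" where
  "zero_free_word = Word []"

fun plus_free_word :: "'a free_word \<Rightarrow> 'a free_word \<Rightarrow> 'a free_word" where
  "plus_free_word (Word u) (Word v) = Word (u @ v)"

instance
proof
  fix a b c :: "'a free_word"
  show "a + b + c = a + (b + c)"
    by (cases a; cases b; cases c) simp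
  show "0 + a = a" "a + 0 = a"
    by (cases a; simp add: zero_free_word_def)+
qed

end

type_synonym 'a free_algebra = "'a free_word \<Rightarrow>\<^sub>0 complex"

definition free_gen :: "'a \<Rightarrow> 'a free_algebra" where
  "free_gen x = Poly_Mapping.single (Word [x]) 1"

definition free_const :: "complex \<Rightarrow> 'a free_algebra" where
  "free_const c = Poly_Mapping.single 0 c"

definition free_ring :: "'a free_algebra ring" where
  "free_ring = \<lparr>carrier = UNIV, mult = (*), one = 1, zero = 0, add = (+)\<rparr>"

lemma ring_free_ring: "ring (free_ring :: 'a free_algebra ring)"
proof -
  have "\<exists>y. y + x = 0 \<and> x + y = 0" for x :: "'a free_algebra"
    by (intro exI[of _ "- x"]) simp
  then show ?thesis
    unfolding free_ring_def by unfold_locales (auto simp: algebra_simps Units_def)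
qed


section \<open>The deformed generalized Weyl algebra\<close>

datatype weyl_gen = GenX | GenY | GenZ

text \<open>
  The relator \<open>Z - 1\<close> implements the convention that \<open>Z\<^sub>1\<close> is the identity.
\<close>

definition weyl_relators ::
    "nat \<Rightarrow> complex \<Rightarrow> complex \<Rightarrow> complex \<Rightarrow> weyl_gen free_algebra set" where
  "weyl_relators s h p q =
     (let X = free_gen GenX; Y = free_gen GenY; Z = free_gen GenZ in
      {X * Y - free_const q * Y * X - free_const h * Y ^ s * Z,
       Z * Y - free_const p * Y * Z,
       X * Z - free_const p * Z * X}
      \<union> (if p = 1 then {Z - 1} else {}))"

definition weyl_ideal ::
    "nat \<Rightarrow> complex \<Rightarrow> complex \<Rightarrow> complex \<Rightarrow> weyl_gen free_algebra set" where
  "weyl_ideal s h p q = Idl\<^bsub>free_ring\<^esub> (weyl_relators s h p q)"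

definition weyl_algebra ::
    "nat \<Rightarrow> complex \<Rightarrow> complex \<Rightarrow> complex \<Rightarrow> weyl_gen free_algebra set ring" where
  "weyl_algebra s h p q = free_ring Quot weyl_ideal s h p q"

definition weyl_class ::
    "nat \<Rightarrow> complex \<Rightarrow> complex \<Rightarrow> complex \<Rightarrow> weyl_gen free_algebra \<Rightarrow> weyl_gen free_algebra set" where
  "weyl_class s h p q f = weyl_ideal s h p q +>\<^bsub>free_ring\<^esub> f"

definition weyl_X where "weyl_X s h p q = weyl_class s h p q (free_gen GenX)"
definition weyl_Y where "weyl_Y s h p q = weyl_class s h p q (free_gen GenY)"
definition weyl_Z where "weyl_Z s h p q = weyl_class s h p q (free_gen GenZ)"

text \<open>The action of the complex scalars, that is, multiplication by the class of a constant.\<close>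

definition weyl_scale ::
    "nat \<Rightarrow> complex \<Rightarrow> complex \<Rightarrow> complex \<Rightarrow> complex \<Rightarrow>
      weyl_gen free_algebra set \<Rightarrow> weyl_gen free_algebra set" where
  "weyl_scale s h p q c a = weyl_class s h p q (free_const c) \<otimes>\<^bsub>weyl_algebra s h p q\<^esub> a"

lemma ideal_weyl_ideal: "ideal (weyl_ideal s h p q) free_ring"
  unfolding weyl_ideal_def
  by (rule ring.genideal_ideal[OF ring_free_ring]) (simp add: free_ring_def)

lemma ring_weyl_algebra: "ring (weyl_algebra s h p q)"
  unfolding weyl_algebra_def by (rule ideal.quotient_is_ring[OF ideal_weyl_ideal])


section \<open>Twin-basic numbers and generalized Stirling numbers\<close>

text \<open>
  The polynomial form \<open>p^(k-1) + p^(k-2) q + \<dots> + q^(k-1)\<close>, which also makes sense for \<open>p = q\<close>.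
\<close>

definition twin_basic :: "complex \<Rightarrow> complex \<Rightarrow> nat \<Rightarrow> complex" where
  "twin_basic p q k = (\<Sum>i<k. p ^ (k - 1 - i) * q ^ i)"

lemma twin_basic_eq_quotient:
  assumes "p \<noteq> q"
  shows "twin_basic p q k = (p ^ k - q ^ k) / (p - q)"
proof -
  have "q ^ k - p ^ k = (q - p) * twin_basic p q k"
    unfolding twin_basic_def by (subst power_diff_sumr2) (simp add: mult.commute)
  then show ?thesis
    using assms by (simp add: field_simps)
qed

text \<open>
  The guards implement the convention that a term containing a Stirling number with lower index
  negative or exceeding the upper one is \<open>0\<close>; in the guarded terms no natural-number subtraction
  truncates.
\<close>

fun gen_stirling :: "nat \<Rightarrow> complex \<Rightarrow> complex \<Rightarrow> complex \<Rightarrow> nat \<Rightarrow> nat \<Rightarrow> complex" where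
  "gen_stirling s h p q 0 k = (if k = 0 then 1 else 0)"
| "gen_stirling s h p q (Suc n) k =
     (if 1 \<le> k \<and> k \<le> n + 1
      then p ^ (n + 1 - k) * q ^ (s * (n + 1 - k) + k - 1) * gen_stirling s h p q n (k - 1)
      else 0)
     + (if k \<le> n
        then h * twin_basic p q (s * (n - k) + k) * gen_stirling s h p q n k
        else 0)"


section \<open>Rook placements with row creation\<close>

text \<open>
  A Ferrers board is the list of its column heights from left to right. Columns and rows are numbered
  from 0, columns from left to right and rows from top to bottom; a box is a pair (column, row).
\<close>

type_synonym board = "nat list"

definition ferrers_board :: "board \<Rightarrow> bool" where
  "ferrers_board B \<longleftrightarrow> sorted_wrt (\<ge>) B"

definition staircase :: "nat \<Rightarrow> board" where
  "staircase n = rev [1..<n]"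

lemma ferrers_board_staircase: "ferrers_board (staircase n)"
  unfolding ferrers_board_def staircase_def sorted_wrt_rev using sorted_upt[of 1 n] by simp

text \<open>
  A placement maps a column to the row of its rook, if there is one. The row is the position in that
  column of the board enlarged by the rows created by the rooks further right; rooks further left
  create no boxes in this column.
\<close>

type_synonym rooks = "nat \<Rightarrow> nat option"

definition column_height :: "nat \<Rightarrow> board \<Rightarrow> rooks \<Rightarrow> nat \<Rightarrow> nat" where
  "column_height s B \<phi> j = B ! j + s * card {i. j < i \<and> i < length B \<and> \<phi> i \<noteq> None}"

definition boxes :: "nat \<Rightarrow> board \<Rightarrow> rooks \<Rightarrow> (nat \<times> nat) set" where
  "boxes s B \<phi> = {(j, r). j < length B \<and> r < column_height s B \<phi> j}"

text \<open>
  A row at position \<open>r\<close> in some column is continued in the next column to the left at position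
  \<open>r + s\<close> if it lies below a rook of the former column, since the \<open>s\<close> rows created
  immediately beneath that rook push it down, and at position \<open>r\<close> otherwise.
  \<open>row_in s \<phi> i j\<close> is the position in column \<open>j < i\<close> of the row of the rook in
  column \<open>i\<close>, which passes the columns \<open>i - 1, \<dots>, j + 1\<close> on its way.
\<close>

definition continue_row :: "nat \<Rightarrow> nat option \<Rightarrow> nat \<Rightarrow> nat" where
  "continue_row s rook r =
     (case rook of None \<Rightarrow> r | Some r' \<Rightarrow> if r > r' then r + s else r)"

definition row_in :: "nat \<Rightarrow> rooks \<Rightarrow> nat \<Rightarrow> nat \<Rightarrow> nat" where
  "row_in s \<phi> i j = foldr (\<lambda>m. continue_row s (\<phi> m)) [Suc j..<i] (the (\<phi> i))"

definition left_of_rook :: "nat \<Rightarrow> rooks \<Rightarrow> nat \<times> nat \<Rightarrow> bool" where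
  "left_of_rook s \<phi> = (\<lambda>(j, r). \<exists>i>j. \<phi> i \<noteq> None \<and> row_in s \<phi> i j = r)"

definition above_rook :: "rooks \<Rightarrow> nat \<times> nat \<Rightarrow> bool" where
  "above_rook \<phi> = (\<lambda>(j, r). \<exists>r'>r. \<phi> j = Some r')"

definition in_rook_column :: "rooks \<Rightarrow> nat \<times> nat \<Rightarrow> bool" where
  "in_rook_column \<phi> = (\<lambda>(j, r). \<phi> j \<noteq> None)"

definition rook_boxes :: "rooks \<Rightarrow> (nat \<times> nat) set" where
  "rook_boxes \<phi> = {(j, r). \<phi> j = Some r}"

definition rook_placements :: "nat \<Rightarrow> board \<Rightarrow> nat \<Rightarrow> rooks set" where
  "rook_placements s B k =
     {\<phi>. rook_boxes \<phi> \<subseteq> boxes s B \<phi> \<and> card (rook_boxes \<phi>) = k \<and>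
          (\<forall>b \<in> rook_boxes \<phi>. \<not> left_of_rook s \<phi> b)}"

definition t_boxes :: "nat \<Rightarrow> board \<Rightarrow> rooks \<Rightarrow> (nat \<times> nat) set" where
  "t_boxes s B \<phi> =
     {b \<in> boxes s B \<phi> - rook_boxes \<phi>. above_rook \<phi> b \<and> \<not> left_of_rook s \<phi> b}"

definition l_boxes :: "nat \<Rightarrow> board \<Rightarrow> rooks \<Rightarrow> (nat \<times> nat) set" where
  "l_boxes s B \<phi> =
     {b \<in> boxes s B \<phi> - rook_boxes \<phi>. left_of_rook s \<phi> b \<and> \<not> in_rook_column \<phi> b}"

definition cancelled_boxes :: "nat \<Rightarrow> board \<Rightarrow> rooks \<Rightarrow> (nat \<times> nat) set" where
  "cancelled_boxes s B \<phi> =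
     {b \<in> boxes s B \<phi> - rook_boxes \<phi>. left_of_rook s \<phi> b \<and> in_rook_column \<phi> b}"

definition e_boxes :: "nat \<Rightarrow> board \<Rightarrow> rooks \<Rightarrow> (nat \<times> nat) set" where
  "e_boxes s B \<phi> =
     boxes s B \<phi> - (rook_boxes \<phi> \<union> t_boxes s B \<phi> \<union> l_boxes s B \<phi> \<union> cancelled_boxes s B \<phi>)"

definition rook_weight ::
    "nat \<Rightarrow> complex \<Rightarrow> complex \<Rightarrow> complex \<Rightarrow> board \<Rightarrow> rooks \<Rightarrow> complex" where
  "rook_weight s h p q B \<phi> =
     h ^ card (rook_boxes \<phi>)
     * p ^ (card (t_boxes s B \<phi>) + card (l_boxes s B \<phi>))
     * q ^ card (e_boxes s B \<phi>)"

definition rook_number ::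
    "nat \<Rightarrow> complex \<Rightarrow> complex \<Rightarrow> complex \<Rightarrow> board \<Rightarrow> nat \<Rightarrow> complex" where
  "rook_number s h p q B k = (\<Sum>\<phi> \<in> rook_placements s B k. rook_weight s h p q B \<phi>)"

text \<open>Hence the sum in \<^const>\<open>rook_number\<close> is not one over an infinite set.\<close>

lemma finite_rook_placements: "finite (rook_placements s B k)"
proof -
  define M where "M = Max (insert 0 (set B)) + s * length B"
  have sub: "rook_boxes \<phi> \<subseteq> {..<length B} \<times> {..<M}" if "\<phi> \<in> rook_placements s B k" for \<phi>
  proof (rule subsetI, clarify)
    fix j r assume "(j, r) \<in> rook_boxes \<phi>"
    with that have *: "j < length B" "r < column_height s B \<phi> j"
      by (auto simp: rook_placements_def boxes_def)
    have "card {i. j < i \<and> i < length B \<and> \<phi> i \<noteq> None} \<le> card {..<length B}"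
      by (rule card_mono) auto
    moreover have "B ! j \<le> Max (insert 0 (set B))"
      using *(1) by (intro Max_ge) auto
    ultimately have "column_height s B \<phi> j \<le> M"
      unfolding column_height_def M_def by (intro add_mono mult_left_mono) auto
    with * show "j \<in> {..<length B} \<and> r \<in> {..<M}" by auto
  qed
  have inj: "inj_on rook_boxes (rook_placements s B k)"
  proof (rule inj_onI, rule ext)
    fix \<phi> \<psi> :: rooks and j
    assume "rook_boxes \<phi> = rook_boxes \<psi>"
    then have "\<And>r. \<phi> j = Some r \<longleftrightarrow> \<psi> j = Some r"
      by (auto simp: rook_boxes_def set_eq_iff)
    then show "\<phi> j = \<psi> j" by (metis option.exhaust)
  qed
  have "rook_boxes ` rook_placements s B k \<subseteq> Pow ({..<length B} \<times> {..<M})"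
    using sub by auto
  then have "finite (rook_boxes ` rook_placements s B k)"
    by (rule finite_subset) simp
  then show ?thesis using inj by (rule finite_imageD)
qed

end

theory Submission
  imports Defs
begin

text \<open>
  Moving \<open>Y X\<close> past \<open>Y^a Z^b X^k\<close> with \<open>X Y^a = q^a Y^a X + h [a] Y^(a+s-1) Z\<close>
  shows that the normal ordering coefficients satisfy the Stirling recurrence. The rook numbers of the
  staircase boards satisfy the same recurrence: \<open>J_(n+1)\<close> is \<open>J_n\<close> with a column of height
  \<open>n\<close> added on the left, and with \<open>b\<close> rooks on \<open>J_n\<close> exactly
  \<open>n + s b - b\<close> boxes of that column are free. Leaving the column empty contributes
  \<open>p^b q^(n + s b - b)\<close>; a rook in the free box with \<open>i\<close> free boxes above and \<open>j\<close>
  below it contributes \<open>h p^i q^j\<close>, and these weights sum to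
  \<open>h [n + s b - b]\<close>.
\<close>

section \<open>Normal ordering\<close>

text \<open>A constant is supported on the empty word, which is neutral for concatenation, so it
  commutes with every monomial.\<close>

lemma free_const_commute: "f * free_const c = free_const c * f"
proof (induction f rule: update_induct)
  case const
  show ?case by simp
next
  case (update f a b)
  \<comment> \<open>Since \<open>a\<close> is not a key of \<open>f\<close>, updating amounts to
    adding a monomial.\<close>
  have "Poly_Mapping.update a b f = f + Poly_Mapping.single a b"
    using update(1) by (intro poly_mapping_eqI)
      (auto simp: lookup_update lookup_add lookup_single in_keys_iff when_def)
  moreover have "Poly_Mapping.single a b * free_const c = free_const c * Poly_Mapping.single a b"
    by (simp add: free_const_def mult_single mult.commute)
  ultimately show ?case
    using update(3) by (simp add: distrib_left distrib_right)
qed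

lemma free_const_left_commute: "f * (free_const c * g) = free_const c * (f * g)"
  by (metis free_const_commute mult.assoc)

lemma free_const_mult: "free_const c * free_const d = free_const (c * d)"
  by (simp add: free_const_def mult_single)

lemma free_const_mult_left: "free_const c * (free_const d * f) = free_const (c * d) * f"
  by (metis free_const_mult mult.assoc)

lemma free_const_add: "free_const (c + d) = free_const c + free_const d"
  by (simp add: free_const_def single_add)

lemma free_const_0 [simp]: "free_const 0 = 0"
  by (simp add: free_const_def)

lemma free_const_1 [simp]: "free_const 1 = 1"
  by (simp add: free_const_def)

section \<open>Passage from the free algebra to the quotient\<close>

lemma weyl_class_in_carrier: "weyl_class s h p q f \<in> carrier (weyl_algebra s h p q)"
  by (auto simp: weyl_class_def weyl_algebra_def FactRing_def A_RCOSETS_def' free_ring_def)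

lemma weyl_class_hom: "weyl_class s h p q \<in> ring_hom free_ring (weyl_algebra s h p q)"
  using ideal.rcos_ring_hom[OF ideal_weyl_ideal, of s h p q]
  by (simp add: weyl_class_def[abs_def] weyl_algebra_def)

lemma weyl_class_mult:
  "weyl_class s h p q (f * g) =
     weyl_class s h p q f \<otimes>\<^bsub>weyl_algebra s h p q\<^esub> weyl_class s h p q g"
  using ring_hom_mult[OF weyl_class_hom, of f g s h p q] by (simp add: free_ring_def)

lemma weyl_class_add:
  "weyl_class s h p q (f + g) =
     weyl_class s h p q f \<oplus>\<^bsub>weyl_algebra s h p q\<^esub> weyl_class s h p q g"
  using ring_hom_add[OF weyl_class_hom, of f g s h p q] by (simp add: free_ring_def)

lemma weyl_class_1: "weyl_class s h p q 1 = \<one>\<^bsub>weyl_algebra s h p q\<^esub>"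
  using ring_hom_one[OF weyl_class_hom, of s h p q] by (simp add: free_ring_def)

lemma weyl_class_0: "weyl_class s h p q 0 = \<zero>\<^bsub>weyl_algebra s h p q\<^esub>"
  using ring_hom_zero[OF weyl_class_hom ring_free_ring ring_weyl_algebra, of s h p q]
  by (simp add: free_ring_def)

lemma weyl_class_power:
  "weyl_class s h p q (f ^ n) = weyl_class s h p q f [^]\<^bsub>weyl_algebra s h p q\<^esub> n"
  by (induction n) (simp_all add: weyl_class_1 weyl_class_mult power_Suc2 del: power_Suc)

lemma weyl_class_sum:
  assumes "finite I"
  shows "weyl_class s h p q (\<Sum>i\<in>I. f i) =
     (\<Oplus>\<^bsub>weyl_algebra s h p q\<^esub>i\<in>I. weyl_class s h p q (f i))"
proof -
  interpret ring "weyl_algebra s h p q" by (rule ring_weyl_algebra)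
  show ?thesis
    using assms by induction (simp_all add: weyl_class_0 weyl_class_add weyl_class_in_carrier)
qed

text \<open>Calculations are done on representatives in the free algebra, where the type class rules
  for rings apply. This rule and the next two exchange a factor or summand for another
  representative of its class.\<close>

lemma weyl_class_mult_cong:
  assumes "weyl_class s h p q f = weyl_class s h p q f'"
    and "weyl_class s h p q g = weyl_class s h p q g'"
  shows "weyl_class s h p q (f * g) = weyl_class s h p q (f' * g')"
  using assms by (simp add: weyl_class_mult)

lemma weyl_class_add_cong:
  assumes "weyl_class s h p q f = weyl_class s h p q f'"
    and "weyl_class s h p q g = weyl_class s h p q g'"
  shows "weyl_class s h p q (f + g) = weyl_class s h p q (f' + g')"
  using assms by (simp add: weyl_class_add)

lemma weyl_class_sum_cong:
  assumes "finite I" and "\<And>i. i \<in> I \<Longrightarrow> weyl_class s h p q (f i) = weyl_class s h p q (g i)"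
  shows "weyl_class s h p q (\<Sum>i\<in>I. f i) = weyl_class s h p q (\<Sum>i\<in>I. g i)"
  using assms
proof (induction I)
  case (insert i I)
  then have "weyl_class s h p q (f i + sum f I) = weyl_class s h p q (g i + sum g I)"
    by (intro weyl_class_add_cong) auto
  with insert show ?case by simp
qed simp

text \<open>A relator lies in the ideal and so has class zero; now write
  \<open>f = (f - g) + g\<close>.\<close>

lemma weyl_class_eqI:
  assumes "f - g \<in> weyl_relators s h p q"
  shows "weyl_class s h p q f = weyl_class s h p q g"
proof -
  interpret ideal "weyl_ideal s h p q" "free_ring" by (rule ideal_weyl_ideal)
  have "f - g \<in> weyl_ideal s h p q"
    using ring.genideal_self[OF ring_free_ring, of "weyl_relators s h p q"] assms
    by (auto simp: weyl_ideal_def free_ring_def)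
  then have "weyl_class s h p q (f - g) = \<zero>\<^bsub>weyl_algebra s h p q\<^esub>"
    using a_rcos_const by (simp add: weyl_class_def weyl_algebra_def FactRing_def)
  moreover interpret A: ring "weyl_algebra s h p q" by (rule ring_weyl_algebra)
  have "weyl_class s h p q f =
      weyl_class s h p q (f - g) \<oplus>\<^bsub>weyl_algebra s h p q\<^esub> weyl_class s h p q g"
    by (simp flip: weyl_class_add)
  ultimately show ?thesis
    by (simp add: weyl_class_in_carrier)
qed

section \<open>Commutation of powers of the generators\<close>

text \<open>The summand with index \<open>m\<close> is \<open>q ^ m\<close>; every other summand
  contains a factor \<open>p\<close>.\<close>

lemma twin_basic_Suc: "twin_basic p q (Suc m) = p * twin_basic p q m + q ^ m"
  unfolding twin_basic_def
  by (simp add: sum_distrib_left mult.assoc Suc_diff_Suc flip: power_Suc mult.assoc)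

context
  fixes s :: nat and h p q :: complex and X Y Z :: "weyl_gen free_algebra"
  defines "X \<equiv> free_gen GenX" and "Y \<equiv> free_gen GenY" and "Z \<equiv> free_gen GenZ"
begin

text \<open>Only these instances are used for simplification: the general rule could also swap two
  constants, endlessly.\<close>

lemmas free_const_gen_left_commute =
  free_const_left_commute[of X] free_const_left_commute[of Y] free_const_left_commute[of Z]
  free_const_left_commute[of "X ^ n" for n] free_const_left_commute[of "Y ^ n" for n]
  free_const_left_commute[of "Z ^ n" for n]

lemma weyl_class_X_Y:
  "weyl_class s h p q (X * Y) =
     weyl_class s h p q (free_const q * (Y * X) + free_const h * (Y ^ s * Z))"
  by (rule weyl_class_eqI)
    (simp add: weyl_relators_def Let_def X_def Y_def Z_def algebra_simps)

lemma weyl_class_Z_Y: "weyl_class s h p q (Z * Y) = weyl_class s h p q (free_const p * (Y * Z))"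
  by (rule weyl_class_eqI)
    (simp add: weyl_relators_def Let_def X_def Y_def Z_def mult.assoc)

lemma weyl_class_X_Z: "weyl_class s h p q (X * Z) = weyl_class s h p q (free_const p * (Z * X))"
  by (rule weyl_class_eqI)
    (simp add: weyl_relators_def Let_def X_def Y_def Z_def mult.assoc)

lemma weyl_class_X_Z_power:
  "weyl_class s h p q (X * Z ^ b) = weyl_class s h p q (free_const (p ^ b) * (Z ^ b * X))"
proof (induction b)
  case (Suc b)
  have "weyl_class s h p q (X * Z ^ Suc b) = weyl_class s h p q (X * Z ^ b * Z)"
    by (simp add: mult.assoc power_Suc2 del: power_Suc)
  also have "\<dots> = weyl_class s h p q (free_const (p ^ b) * (Z ^ b * X) * Z)"
    by (intro weyl_class_mult_cong Suc refl)
  also have "\<dots> = weyl_class s h p q (free_const (p ^ b) * Z ^ b * (X * Z))"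
    by (simp add: mult.assoc)
  also have "\<dots> = weyl_class s h p q (free_const (p ^ b) * Z ^ b * (free_const p * (Z * X)))"
    by (intro weyl_class_mult_cong weyl_class_X_Z refl)
  also have "free_const (p ^ b) * Z ^ b * (free_const p * (Z * X)) =
      free_const (p ^ Suc b) * (Z ^ Suc b * X)"
    by (simp add: mult.assoc free_const_gen_left_commute free_const_mult_left power_commutes mult.commute
        flip: power_Suc2)
      (simp add: mult.assoc power_commutes flip: mult.assoc)
  finally show ?case .
qed simp

text \<open>Moving one more \<open>Y\<close> to the left turns \<open>X\<close> into
  \<open>q Y X + h Y^s Z\<close> and gives the \<open>Z\<close> of the second term a factor
  \<open>p\<close>. The coefficient of that term therefore follows the recursion
  \<open>twin_basic_Suc\<close>. With \<open>s = Suc s'\<close> the exponent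
  \<open>m + s - 1\<close> needs no subtraction.\<close>

lemma weyl_class_X_Y_power:
  assumes "s = Suc s'"
  shows "weyl_class s h p q (X * Y ^ m) =
     weyl_class s h p q (free_const (q ^ m) * (Y ^ m * X)
       + free_const (h * twin_basic p q m) * (Y ^ (m + s') * Z))"
proof (induction m)
  case (Suc m)
  have "weyl_class s h p q (X * Y ^ Suc m) = weyl_class s h p q (X * Y ^ m * Y)"
    by (simp add: mult.assoc power_Suc2 del: power_Suc)
  also have "\<dots> = weyl_class s h p q ((free_const (q ^ m) * (Y ^ m * X)
       + free_const (h * twin_basic p q m) * (Y ^ (m + s') * Z)) * Y)"
    by (intro weyl_class_mult_cong Suc refl)
  also have "\<dots> = weyl_class s h p q (free_const (q ^ m) * Y ^ m * (X * Y)
       + free_const (h * twin_basic p q m) * Y ^ (m + s') * (Z * Y))"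
    by (simp add: algebra_simps)
  also have "\<dots> = weyl_class s h p q (
       free_const (q ^ m) * Y ^ m * (free_const q * (Y * X) + free_const h * (Y ^ s * Z))
       + free_const (h * twin_basic p q m) * Y ^ (m + s') * (free_const p * (Y * Z)))"
    by (intro weyl_class_add_cong weyl_class_mult_cong weyl_class_X_Y weyl_class_Z_Y refl)
  also have "free_const (q ^ m) * Y ^ m * (free_const q * (Y * X) + free_const h * (Y ^ s * Z))
       + free_const (h * twin_basic p q m) * Y ^ (m + s') * (free_const p * (Y * Z)) =
     free_const (q ^ m * q) * (Y ^ m * Y * X) +
     free_const (q ^ m * h) * (Y ^ (m + s) * Z) +
     free_const (h * twin_basic p q m * p) * (Y ^ (m + s') * Y * Z)"
    by (simp add: distrib_left mult.assoc free_const_gen_left_commute free_const_mult_left power_add)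
  also have "\<dots> = free_const (q ^ Suc m) * (Y ^ Suc m * X)
      + free_const (h * twin_basic p q (Suc m)) * (Y ^ (Suc m + s') * Z)"
    by (simp add: assms twin_basic_Suc free_const_add algebra_simps flip: power_Suc2)
  finally show ?case .
qed (simp add: twin_basic_def)

text \<open>If \<open>X\<close> survives the passage through \<open>Y ^ a\<close>, it must still
  cross \<open>Z ^ b\<close>, which costs \<open>p ^ b\<close>. The \<open>Z\<close> created
  otherwise already stands next to \<open>Z ^ b\<close>.\<close>

lemma weyl_class_YX_monomial:
  assumes "s \<ge> 1"
  shows "weyl_class s h p q (Y * X * (Y ^ a * Z ^ b * X ^ k)) =
     weyl_class s h p q (free_const (p ^ b * q ^ a) * (Y ^ Suc a * Z ^ b * X ^ Suc k)
       + free_const (h * twin_basic p q a) * (Y ^ (a + s) * Z ^ Suc b * X ^ k))"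
proof -
  obtain s' where s: "s = Suc s'"
    using assms by (cases s) auto
  have "weyl_class s h p q (Y * X * (Y ^ a * Z ^ b * X ^ k)) =
      weyl_class s h p q (Y * (X * Y ^ a) * (Z ^ b * X ^ k))"
    by (simp add: mult.assoc)
  also have "\<dots> = weyl_class s h p q (Y * (free_const (q ^ a) * (Y ^ a * X)
       + free_const (h * twin_basic p q a) * (Y ^ (a + s') * Z)) * (Z ^ b * X ^ k))"
    by (intro weyl_class_mult_cong weyl_class_X_Y_power[OF s] refl)
  also have "\<dots> = weyl_class s h p q (free_const (q ^ a) * Y ^ Suc a * (X * Z ^ b) * X ^ k
       + free_const (h * twin_basic p q a) * (Y ^ (a + s) * Z ^ Suc b * X ^ k))"
    by (simp add: s distrib_left distrib_right mult.assoc free_const_gen_left_commute)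
  also have "\<dots> = weyl_class s h p q (
       free_const (q ^ a) * Y ^ Suc a * (free_const (p ^ b) * (Z ^ b * X)) * X ^ k
       + free_const (h * twin_basic p q a) * (Y ^ (a + s) * Z ^ Suc b * X ^ k))"
    by (intro weyl_class_add_cong weyl_class_mult_cong weyl_class_X_Z_power refl)
  also have "free_const (q ^ a) * Y ^ Suc a * (free_const (p ^ b) * (Z ^ b * X)) * X ^ k =
      free_const (p ^ b * q ^ a) * (Y ^ Suc a * Z ^ b * X ^ Suc k)"
    by (simp add: mult.assoc free_const_gen_left_commute free_const_mult_left mult.commute)
  finally show ?thesis .
qed

lemma weyl_class_normal_ordering:
  assumes "s \<ge> 1"
  shows "weyl_class s h p q ((Y * X) ^ n) =
     weyl_class s h p q (\<Sum>k\<le>n. free_const (gen_stirling s h p q n k) *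
       (Y ^ (s * (n - k) + k) * Z ^ (n - k) * X ^ k))"
proof (induction n)
  case (Suc n)
  define M where "M n k = Y ^ (s * (n - k) + k) * Z ^ (n - k) * X ^ k" for n k
  define S where "S = gen_stirling s h p q"
  \<comment> \<open>The monomial \<open>M n k\<close> contributes to
    \<open>M (Suc n) (Suc k)\<close> with coefficient \<open>U k\<close> and to
    \<open>M (Suc n) k\<close> with coefficient \<open>V k\<close>.\<close>
  define U where "U k = p ^ (n - k) * q ^ (s * (n - k) + k)" for k
  define V where "V k = h * twin_basic p q (s * (n - k) + k)" for k
  have "weyl_class s h p q ((Y * X) ^ Suc n) = weyl_class s h p q (Y * X * (Y * X) ^ n)"
    by simp
  also have "\<dots> = weyl_class s h p q (Y * X * (\<Sum>k\<le>n. free_const (S n k) * M n k))"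
    by (intro weyl_class_mult_cong refl) (simp only: M_def S_def Suc)
  also have "Y * X * (\<Sum>k\<le>n. free_const (S n k) * M n k) =
      (\<Sum>k\<le>n. free_const (S n k) * (Y * X * M n k))"
    by (simp only: sum_distrib_left free_const_left_commute[of "Y * X"])
  also have "weyl_class s h p q \<dots> = weyl_class s h p q (\<Sum>k\<le>n. free_const (S n k) *
      (free_const (U k) * M (Suc n) (Suc k) + free_const (V k) * M (Suc n) k))"
  proof (intro weyl_class_sum_cong weyl_class_mult_cong refl)
    fix k assume "k \<in> {..n}"
    then obtain j where "n = k + j"
      using le_Suc_ex by auto
    then show "weyl_class s h p q (Y * X * M n k) =
        weyl_class s h p q (free_const (U k) * M (Suc n) (Suc k) + free_const (V k) * M (Suc n) k)"
      unfolding M_def U_def V_def weyl_class_YX_monomial[OF assms]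
      by (simp add: Suc_diff_le add_ac)
  qed simp
  also have "(\<Sum>k\<le>n. free_const (S n k) *
      (free_const (U k) * M (Suc n) (Suc k) + free_const (V k) * M (Suc n) k)) =
     (\<Sum>k\<le>n. free_const (U k * S n k) * M (Suc n) (Suc k)) +
     (\<Sum>k\<le>n. free_const (V k * S n k) * M (Suc n) k)"
    by (simp add: distrib_left free_const_mult_left sum.distrib mult.commute)
  \<comment> \<open>Both sums are extended to the common range \<open>k \<le> Suc n\<close>. The
    guards that annihilate the additional terms are those in the recurrence of
    \<open>gen_stirling\<close>.\<close>
  also have "(\<Sum>k\<le>n. free_const (U k * S n k) * M (Suc n) (Suc k)) =
     (\<Sum>k\<le>Suc n. free_const (if 1 \<le> k then U (k - 1) * S n (k - 1) else 0) * M (Suc n) k)"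
    by (simp add: sum.atMost_Suc_shift del: sum.atMost_Suc)
  also have "(\<Sum>k\<le>n. free_const (V k * S n k) * M (Suc n) k) =
     (\<Sum>k\<le>Suc n. free_const (if k \<le> n then V k * S n k else 0) * M (Suc n) k)"
    by simp
  also have "(\<Sum>k\<le>Suc n. free_const (if 1 \<le> k then U (k - 1) * S n (k - 1) else 0) * M (Suc n) k) +
     (\<Sum>k\<le>Suc n. free_const (if k \<le> n then V k * S n k else 0) * M (Suc n) k) =
     (\<Sum>k\<le>Suc n. free_const (S (Suc n) k) * M (Suc n) k)"
    unfolding sum.distrib[symmetric] distrib_right[symmetric] free_const_add[symmetric]
    by (intro sum.cong refl arg_cong2[of _ _ _ _ "(*)"] arg_cong[of _ _ free_const])
      (auto simp: S_def U_def V_def algebra_simps)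
  finally show ?case
    by (simp only: M_def S_def)
qed simp

end


section \<open>Adding a column on the left\<close>

text \<open>Here \<open>F\<close> stands for the free rows of a column; only their order matters,
  not their positions. A new largest element has all of \<open>F\<close> above it and contributes
  \<open>p ^ card F\<close>, while every old summand gains a factor \<open>q\<close>. This is the
  recursion obtained by splitting off the first summand of \<open>twin_basic\<close>.\<close>

lemma sum_twin_basic:
  fixes F :: "nat set"
  assumes "finite F"
  shows "(\<Sum>r\<in>F. p ^ card {r' \<in> F. r' < r} * q ^ card {r' \<in> F. r < r'}) =
     twin_basic p q (card F)"
  using assms
proof (induction F rule: finite_linorder_max_induct)
  case empty
  show ?case by (simp add: twin_basic_def)
next
  case (insert b F)
  have b: "b \<notin> F" using insert by auto
  have top: "card {r' \<in> insert b F. r' < b} = card F" "card {r' \<in> insert b F. b < r'} = 0"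
  proof -
    have "{r' \<in> insert b F. r' < b} = F" "{r' \<in> insert b F. b < r'} = {}"
      using insert by auto
    then show "card {r' \<in> insert b F. r' < b} = card F" "card {r' \<in> insert b F. b < r'} = 0"
      by (simp_all only: card.empty)
  qed
  have old: "card {r' \<in> insert b F. r' < r} = card {r' \<in> F. r' < r}"
      "card {r' \<in> insert b F. r < r'} = Suc (card {r' \<in> F. r < r'})" if "r \<in> F" for r
  proof -
    have "{r' \<in> insert b F. r' < r} = {r' \<in> F. r' < r}"
        "{r' \<in> insert b F. r < r'} = insert b {r' \<in> F. r < r'}"
      using insert that by force+
    then show "card {r' \<in> insert b F. r' < r} = card {r' \<in> F. r' < r}"
        "card {r' \<in> insert b F. r < r'} = Suc (card {r' \<in> F. r < r'})"
      using insert(1) b by simp_all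
  qed
  have "(\<Sum>r\<in>insert b F. p ^ card {r' \<in> insert b F. r' < r} * q ^ card {r' \<in> insert b F. r < r'}) =
      p ^ card F + (\<Sum>r\<in>F. p ^ card {r' \<in> F. r' < r} * q ^ Suc (card {r' \<in> F. r < r'}))"
    unfolding sum.insert[OF insert(1) b] top by (simp add: old del: insert_iff cong: sum.cong)
  also have "\<dots> = p ^ card F + q * twin_basic p q (card F)"
    by (simp add: sum_distrib_left mult.left_commute flip: insert.IH)
  also have "\<dots> = twin_basic p q (Suc (card F))"
    unfolding twin_basic_def sum.lessThan_Suc_shift by (simp add: sum_distrib_left mult.left_commute)
  finally show ?case using insert b by simp
qed

section \<open>Effect of a new first column on rows, boxes and columns\<close>

text \<open>
  A rook placement on the board without its first column is described by \<open>\<phi>\<close>, and \<open>case_nat x \<phi>\<close>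
  adds a first column with rook \<open>x\<close>. The positions of the rows of the rooks of \<open>\<phi>\<close> in the new column
  do not depend on \<open>x\<close>, so they can be read off from the choice \<open>x = None\<close>.
\<close>

definition rook_rows :: "nat \<Rightarrow> rooks \<Rightarrow> nat set" where
  "rook_rows s \<phi> = {row_in s (case_nat None \<phi>) (Suc i) 0 | i. \<phi> i \<noteq> None}"

definition rook_columns :: "rooks \<Rightarrow> nat set" where
  "rook_columns \<phi> = {i. \<phi> i \<noteq> None}"

lemma row_in_case_nat_0:
  "row_in s (case_nat x \<phi>) (Suc i) 0 = foldr (\<lambda>m. continue_row s (\<phi> m)) [0..<i] (the (\<phi> i))"
proof -
  have "[Suc 0..<Suc i] = map Suc [0..<i]" by (simp add: map_Suc_upt)
  then show ?thesis unfolding row_in_def by (simp only: foldr_map) (simp add: comp_def)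
qed

lemma row_in_case_nat_Suc: "row_in s (case_nat x \<phi>) (Suc i) (Suc j) = row_in s \<phi> i j"
proof -
  have "[Suc (Suc j)..<Suc i] = map Suc [Suc j..<i]" by (simp only: map_Suc_upt)
  then show ?thesis unfolding row_in_def by (simp only: foldr_map) (simp add: comp_def)
qed

lemma left_of_rook_case_nat_0: "left_of_rook s (case_nat x \<phi>) (0, r) \<longleftrightarrow> r \<in> rook_rows s \<phi>"
proof -
  have "left_of_rook s (case_nat x \<phi>) (0, r) \<longleftrightarrow>
      (\<exists>i. \<phi> i \<noteq> None \<and> row_in s (case_nat x \<phi>) (Suc i) 0 = r)"
    unfolding left_of_rook_def using gr0_conv_Suc by fastforce
  then show ?thesis
    unfolding rook_rows_def row_in_case_nat_0 by auto
qed

lemma left_of_rook_case_nat_Suc: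
  "left_of_rook s (case_nat x \<phi>) (Suc j, r) \<longleftrightarrow> left_of_rook s \<phi> (j, r)"
proof -
  have "left_of_rook s (case_nat x \<phi>) (Suc j, r) \<longleftrightarrow>
      (\<exists>i. Suc i > Suc j \<and> \<phi> i \<noteq> None \<and> row_in s (case_nat x \<phi>) (Suc i) (Suc j) = r)"
    unfolding left_of_rook_def prod.case by (metis Suc_lessE nat.case(2))
  then show ?thesis
    by (auto simp: left_of_rook_def row_in_case_nat_Suc)
qed

lemma rook_boxes_case_nat:
  "(0, r) \<in> rook_boxes (case_nat x \<phi>) \<longleftrightarrow> x = Some r"
  "(Suc j, r) \<in> rook_boxes (case_nat x \<phi>) \<longleftrightarrow> (j, r) \<in> rook_boxes \<phi>"
  by (simp_all add: rook_boxes_def)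

lemma card_rook_boxes: "card (rook_boxes \<phi>) = card (rook_columns \<phi>)"
proof -
  have "bij_betw fst (rook_boxes \<phi>) (rook_columns \<phi>)"
    unfolding bij_betw_def inj_on_def rook_boxes_def rook_columns_def by force
  then show ?thesis by (rule bij_betw_same_card)
qed

lemma finite_boxes: "finite (boxes s B \<phi>)"
proof -
  have "boxes s B \<phi> = (SIGMA j:{..<length B}. {..<column_height s B \<phi> j})"
    by (auto simp: boxes_def)
  then show ?thesis by simp
qed

lemma rook_placements_columns:
  assumes "\<phi> \<in> rook_placements s B k"
  shows "rook_columns \<phi> \<subseteq> {..<length B}" "card (rook_columns \<phi>) = k"
proof -
  show "card (rook_columns \<phi>) = k"
    using assms by (simp add: rook_placements_def card_rook_boxes)
  show "rook_columns \<phi> \<subseteq> {..<length B}"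
    using assms by (auto simp: rook_placements_def rook_columns_def rook_boxes_def boxes_def)
qed

lemma card_Suc_shift:
  "card {i. Suc j < i \<and> i < Suc n \<and> P i} = card {i. j < i \<and> i < n \<and> P (Suc i)}"
proof -
  have "{i. Suc j < i \<and> i < Suc n \<and> P i} = Suc ` {i. j < i \<and> i < n \<and> P (Suc i)}"
    by (auto simp: image_iff) (metis Suc_lessE Suc_less_eq)
  then show ?thesis by (simp add: card_image)
qed

lemma boxes_case_nat_Suc:
  "(Suc j, r) \<in> boxes s (c # B) (case_nat x \<phi>) \<longleftrightarrow> (j, r) \<in> boxes s B \<phi>"
  by (simp add: boxes_def column_height_def card_Suc_shift)

text \<open>\<open>column_height\<close> counts only rooks inside the board; by the hypothesis these
  are all rooks of \<open>\<phi>\<close>.\<close>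

lemma boxes_case_nat_0:
  assumes "rook_columns \<phi> \<subseteq> {..<length B}"
  shows "(0, r) \<in> boxes s (c # B) (case_nat x \<phi>) \<longleftrightarrow> r < c + s * card (rook_columns \<phi>)"
proof -
  have "{i. 0 < i \<and> i < Suc (length B) \<and> (case_nat x \<phi> i) \<noteq> None} = Suc ` rook_columns \<phi>"
    using assms by (auto simp: rook_columns_def image_iff gr0_conv_Suc split: nat.splits)
  then have "card {i. 0 < i \<and> i < Suc (length B) \<and> (case_nat x \<phi> i) \<noteq> None} = card (rook_columns \<phi>)"
    by (simp add: card_image)
  then show ?thesis by (simp add: boxes_def column_height_def)
qed

text \<open>Passing a rook shifts exactly the rows below it, all by \<open>s\<close>, so the order
  of rows is preserved strictly.\<close>

lemma continue_row_inj: "continue_row s x r = continue_row s x r' \<longleftrightarrow> r = r'"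
  by (auto simp: continue_row_def split: option.splits)

text \<open>Rows above the rook stay in place and rows below it move further down, so none is moved
  onto the row of the rook.\<close>

lemma continue_row_eq_rook: "continue_row s (Some r') r = r' \<longleftrightarrow> r = r'"
  by (auto simp: continue_row_def)

text \<open>Seen from a further column on the left, the rook \<open>x\<close> is still at its own
  position because its row passes no column in between; the older rows have passed the column of
  \<open>x\<close>.\<close>

lemma rook_rows_case_nat:
  "rook_rows s (case_nat x \<phi>) = set_option x \<union> continue_row s x ` rook_rows s \<phi>"
proof -
  \<comment> \<open>\<open>g \<phi> i\<close> is the position that the row of rook \<open>i\<close>
    reaches in a column put in front of the board.\<close>
  define g where "g \<phi> i = foldr (\<lambda>m. continue_row s (\<phi> m)) [0..<i] (the (\<phi> i))" for \<phi> i
  have g0: "g (case_nat x \<phi>) 0 = the x" by (simp add: g_def)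
  have gS: "g (case_nat x \<phi>) (Suc i) = continue_row s x (g \<phi> i)" for i
  proof -
    have "[0..<Suc i] = 0 # map Suc [0..<i]" by (simp add: map_Suc_upt upt_conv_Cons del: upt_Suc)
    then show ?thesis unfolding g_def by (simp only: foldr_map foldr.simps) (simp add: comp_def foldr_map)
  qed
  have rows: "rook_rows s \<psi> = {g \<psi> i | i. \<psi> i \<noteq> None}" for \<psi>
    unfolding rook_rows_def row_in_case_nat_0 g_def ..
  have ex: "(\<exists>i. P i) \<longleftrightarrow> P 0 \<or> (\<exists>i. P (Suc i))" for P
    by (metis nat.exhaust)
  have "r \<in> rook_rows s (case_nat x \<phi>) \<longleftrightarrow>
      r \<in> set_option x \<union> continue_row s x ` rook_rows s \<phi>" for r
    unfolding rows mem_Collect_eq ex[where P = "\<lambda>i. _ = g (case_nat x \<phi>) i \<and> _ i"]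
    by (auto simp: g0 gS)
  then show ?thesis by blast
qed

lemma rook_columns_case_nat:
  "rook_columns (case_nat x \<phi>) = (if x = None then {} else {0}) \<union> Suc ` rook_columns \<phi>"
proof -
  have "i \<in> rook_columns (case_nat x \<phi>) \<longleftrightarrow>
      i \<in> (if x = None then {} else {0}) \<union> Suc ` rook_columns \<phi>" for i
    by (cases i) (auto simp: rook_columns_def)
  then show ?thesis by blast
qed

lemma card_rook_columns_case_nat:
  assumes "finite (rook_columns \<phi>)"
  shows "card (rook_columns (case_nat x \<phi>)) = card (rook_columns \<phi>) + card (set_option x)"
proof -
  have "card (rook_columns (case_nat x \<phi>)) =
      card (if x = None then {} else {0::nat}) + card (Suc ` rook_columns \<phi>)"
    unfolding rook_columns_case_nat using assms by (intro card_Un_disjoint) auto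
  then show ?thesis by (cases x) (auto simp: card_image)
qed

section \<open>Placements on the extended board\<close>

text \<open>A rook in the leftmost column neither creates boxes nor forbids any in the columns to
  its right. The conditions on \<open>\<phi>\<close> are thus unchanged, and \<open>x\<close> only
  has to avoid the rook rows within the enlarged new column.\<close>

lemma case_nat_in_rook_placements:
  "case_nat x \<phi> \<in> rook_placements s (c # B) k' \<longleftrightarrow>
     \<phi> \<in> rook_placements s B (card (rook_columns \<phi>)) \<and>
     k' = card (rook_columns \<phi>) + card (set_option x) \<and>
     set_option x \<subseteq> {..<c + s * card (rook_columns \<phi>)} - rook_rows s \<phi>"
proof (cases "rook_boxes \<phi> \<subseteq> boxes s B \<phi>")
  case True
  then have cols: "rook_columns \<phi> \<subseteq> {..<length B}"
    by (auto simp: rook_columns_def rook_boxes_def boxes_def)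
  then have fin: "finite (rook_columns \<phi>)" by (rule finite_subset) simp
  have all: "(\<forall>b. P b) \<longleftrightarrow> (\<forall>r. P (0, r)) \<and> (\<forall>j r. P (Suc j, r))" for P :: "nat \<times> nat \<Rightarrow> bool"
    by (metis nat.exhaust surj_pair)
  show ?thesis
    unfolding rook_placements_def mem_Collect_eq subset_iff Ball_def
      all[of "\<lambda>b. b \<in> rook_boxes (case_nat x \<phi>) \<longrightarrow> _ b"]
    by (auto simp: rook_boxes_case_nat boxes_case_nat_0[OF cols] boxes_case_nat_Suc
        left_of_rook_case_nat_0 left_of_rook_case_nat_Suc card_rook_boxes
        card_rook_columns_case_nat[OF fin])
next
  case False
  moreover have "rook_boxes \<phi> \<subseteq> boxes s B \<phi>" if "case_nat x \<phi> \<in> rook_placements s (c # B) k'"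
  proof safe
    fix j r assume "(j, r) \<in> rook_boxes \<phi>"
    then have "(Suc j, r) \<in> boxes s (c # B) (case_nat x \<phi>)"
      using that by (auto simp: rook_placements_def rook_boxes_case_nat)
    then show "(j, r) \<in> boxes s B \<phi>" by (simp add: boxes_case_nat_Suc)
  qed
  ultimately show ?thesis by (auto simp: rook_placements_def)
qed

lemma case_nat_0_Suc: "case_nat (\<phi> 0) (\<lambda>i. \<phi> (Suc i)) = \<phi>"
  by (auto split: nat.splits)

text \<open>This counts the forbidden boxes of a new column: distinct rook rows stay distinct on
  their way to the left. They also stay inside the column, because heights do not decrease towards
  the left and each rook that pushes rows down by \<open>s\<close> adds \<open>s\<close>
  boxes.\<close>

lemma rook_rows_placement:
  assumes "\<phi> \<in> rook_placements s B k" "ferrers_board B" "\<And>c'. c' \<in> set B \<Longrightarrow> c' \<le> c"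
  shows "finite (rook_rows s \<phi>)" "card (rook_rows s \<phi>) = k" "rook_rows s \<phi> \<subseteq> {..<c + s * k}"
proof -
  have "finite (rook_rows s \<phi>) \<and> card (rook_rows s \<phi>) = k \<and> rook_rows s \<phi> \<subseteq> {..<c + s * k}"
    using assms
  proof (induction B arbitrary: \<phi> k c)
    case Nil
    have "rook_columns \<phi> = {}" "card (rook_columns \<phi>) = k"
      using rook_placements_columns[OF Nil(1)] by auto
    then show ?case by (auto simp: rook_columns_def rook_rows_def)
  next
    case (Cons c' B)
    define x \<phi>' where "x = \<phi> 0" and "\<phi>' = (\<lambda>i. \<phi> (Suc i))"
    have \<phi>: "\<phi> = case_nat x \<phi>'" unfolding x_def \<phi>'_def by (simp only: case_nat_0_Suc)
    define m where "m = card (rook_columns \<phi>')"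
    have *: "\<phi>' \<in> rook_placements s B m" "k = m + card (set_option x)"
        "set_option x \<subseteq> {..<c' + s * m} - rook_rows s \<phi>'"
      using Cons.prems(1) unfolding \<phi> case_nat_in_rook_placements m_def by blast+
    \<comment> \<open>By the Ferrers condition \<open>c'\<close> bounds the heights of the columns
      to its right, so it can serve as the bound for \<open>B\<close>.\<close>
    have IH: "finite (rook_rows s \<phi>')" "card (rook_rows s \<phi>') = m" "rook_rows s \<phi>' \<subseteq> {..<c' + s * m}"
      using Cons.IH[OF *(1), of c'] Cons.prems(2) by (auto simp: ferrers_board_def)
    have "c' \<le> c" using Cons.prems(3) by simp
    show ?case
    proof (cases x)
      case None
      have "continue_row s None = id" by (auto simp: continue_row_def)
      then show ?thesis
        using None IH *(2) \<open>c' \<le> c\<close> by (auto simp: \<phi> rook_rows_case_nat)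
    next
      case (Some r)
      have "inj_on (continue_row s x) (rook_rows s \<phi>')"
        by (simp add: inj_on_def continue_row_inj)
      moreover have "r \<notin> continue_row s x ` rook_rows s \<phi>'"
        using *(3) Some continue_row_eq_rook by (metis DiffD2 image_iff option.set_intros subsetD)
      \<comment> \<open>The possible shift by \<open>s\<close> is absorbed by the bound, since the
        rook in the new column makes \<open>k = m + 1\<close>.\<close>
      moreover have "continue_row s x r' < c + s * k" if "r' \<in> rook_rows s \<phi>'" for r'
        using that IH(3) *(2) \<open>c' \<le> c\<close> Some by (auto simp: continue_row_def)
      moreover have "r < c + s * k"
        using *(2,3) \<open>c' \<le> c\<close> Some by auto
      ultimately show ?thesis
        using IH *(2) Some by (auto simp: \<phi> rook_rows_case_nat card_image)
    qed
  qed
  then show "finite (rook_rows s \<phi>)" "card (rook_rows s \<phi>) = k" "rook_rows s \<phi> \<subseteq> {..<c + s * k}"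
    by auto
qed

lemma card_split_column_0:
  fixes S :: "(nat \<times> nat) set"
  assumes "finite S"
  shows "card S = card {r. (0, r) \<in> S} + card {(j, r). (Suc j, r) \<in> S}"
proof -
  let ?f = "\<lambda>r. (0::nat, r)" and ?g = "\<lambda>(j, r). (Suc j, r)"
  have "S = ?f ` {r. (0, r) \<in> S} \<union> ?g ` {(j, r). (Suc j, r) \<in> S}" (is "_ = ?A \<union> ?B")
  proof -
    have "z \<in> S \<longleftrightarrow> z \<in> ?A \<union> ?B" for z
      by (cases z; cases "fst z") (auto simp: image_iff)
    then show ?thesis by blast
  qed
  moreover from this have "finite ?A" "finite ?B"
    using assms by (metis finite_Un)+
  moreover have "?A \<inter> ?B = {}" by auto
  ultimately have "card S = card ?A + card ?B"
    by (metis card_Un_disjoint)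
  also have "card ?A = card {r. (0, r) \<in> S}"
    by (rule card_image) (auto simp: inj_on_def)
  also have "card ?B = card {(j, r). (Suc j, r) \<in> S}"
    by (rule card_image) (auto simp: inj_on_def)
  finally show ?thesis .
qed

section \<open>Recursion for the rook numbers\<close>

text \<open>Boxes of the old columns keep their types. In an empty new column the rook rows give
  \<ell>-boxes and the free rows e-boxes. If the column has a rook, the free boxes above it are
  t-boxes, those below are e-boxes, and the rook rows are cancelled and carry no weight.\<close>

lemma rook_weight_case_nat:
  fixes s c :: nat and \<phi> :: rooks
  defines "N \<equiv> c + s * card (rook_columns \<phi>)"
  assumes cols: "rook_columns \<phi> \<subseteq> {..<length B}"
    and x: "set_option x \<subseteq> {..<N} - rook_rows s \<phi>" and rows: "rook_rows s \<phi> \<subseteq> {..<N}"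
  shows "rook_weight s h p q (c # B) (case_nat x \<phi>) = rook_weight s h p q B \<phi> *
    (case x of
       None \<Rightarrow> p ^ card (rook_rows s \<phi>) * q ^ card ({..<N} - rook_rows s \<phi>)
     | Some r \<Rightarrow> h * p ^ card {r' \<in> {..<N} - rook_rows s \<phi>. r' < r}
                * q ^ card {r' \<in> {..<N} - rook_rows s \<phi>. r < r'})"
proof -
  let ?\<psi> = "case_nat x \<phi>" and ?F = "{..<N} - rook_rows s \<phi>"
  have N: "(0, r) \<in> boxes s (c # B) ?\<psi> \<longleftrightarrow> r < N" for r
    unfolding N_def by (rule boxes_case_nat_0[OF cols])
  note simps = rook_boxes_case_nat boxes_case_nat_Suc N
    left_of_rook_case_nat_0 left_of_rook_case_nat_Suc
  have fin: "finite (rook_columns \<phi>)" using cols by (rule finite_subset) simp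
  have *: "above_rook ?\<psi> (Suc j, r) \<longleftrightarrow> above_rook \<phi> (j, r)"
      "above_rook ?\<psi> (0, r) \<longleftrightarrow> (case x of None \<Rightarrow> False | Some r' \<Rightarrow> r < r')"
      "in_rook_column ?\<psi> (Suc j, r) \<longleftrightarrow> in_rook_column \<phi> (j, r)"
      "in_rook_column ?\<psi> (0, r) \<longleftrightarrow> x \<noteq> None" for j r
    by (auto simp: above_rook_def in_rook_column_def split: option.splits)
  have fin': "finite (t_boxes s (c # B) ?\<psi>)" "finite (l_boxes s (c # B) ?\<psi>)"
      "finite (e_boxes s (c # B) ?\<psi>)"
    by (auto intro: finite_subset[OF _ finite_boxes] simp: t_boxes_def l_boxes_def e_boxes_def)
  have t: "card (t_boxes s (c # B) ?\<psi>) =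
      card {r \<in> ?F. case x of None \<Rightarrow> False | Some r' \<Rightarrow> r < r'} + card (t_boxes s B \<phi>)"
    unfolding card_split_column_0[OF fin'(1)]
    by (intro arg_cong2[of _ _ _ _ "(+)"] arg_cong[of _ _ card])
      (auto simp: t_boxes_def simps * split: option.splits)
  have l: "card (l_boxes s (c # B) ?\<psi>) = card {r \<in> rook_rows s \<phi>. x = None} + card (l_boxes s B \<phi>)"
    unfolding card_split_column_0[OF fin'(2)]
    using rows x by (intro arg_cong2[of _ _ _ _ "(+)"] arg_cong[of _ _ card])
      (auto simp: l_boxes_def simps *)
  have e: "card (e_boxes s (c # B) ?\<psi>) =
      card {r \<in> ?F. case x of None \<Rightarrow> True | Some r' \<Rightarrow> r' < r} + card (e_boxes s B \<phi>)"
    unfolding card_split_column_0[OF fin'(3)]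
    by (intro arg_cong2[of _ _ _ _ "(+)"] arg_cong[of _ _ card])
      (auto simp: e_boxes_def t_boxes_def l_boxes_def cancelled_boxes_def simps * split: option.splits)
  show ?thesis
    unfolding rook_weight_def t l e card_rook_boxes card_rook_columns_case_nat[OF fin]
    by (cases x) (simp_all add: power_add mult.commute mult.left_commute set_diff_eq)
qed

text \<open>Placements are split by whether the first column is empty, which leaves \<open>k\<close>
  rooks on \<open>B\<close>, or holds a rook, which leaves \<open>k - 1\<close>.\<close>

lemma rook_number_Cons:
  assumes "ferrers_board (c # B)"
  shows "rook_number s h p q (c # B) k =
     p ^ k * q ^ (c + s * k - k) * rook_number s h p q B k +
     (case k of 0 \<Rightarrow> 0 | Suc b \<Rightarrow> h * twin_basic p q (c + s * b - b) * rook_number s h p q B b)"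
proof -
  define F where "F b \<phi> = {..<c + s * b} - rook_rows s \<phi>" for b \<phi>
  \<comment> \<open>\<open>P\<close> parametrizes the placements with a rook in the first column by
    the remaining placement and the free row used; for \<open>k = 0\<close> there are none.\<close>
  define P where "P = (case k of 0 \<Rightarrow> {} | Suc b \<Rightarrow> SIGMA \<phi>:rook_placements s B b. F b \<phi>)"
  define f where "f = (\<lambda>(\<phi>, r). case_nat (Some r) \<phi> :: rooks)"
  have B: "ferrers_board B" and c: "\<And>c'. c' \<in> set B \<Longrightarrow> c' \<le> c"
    using assms by (auto simp: ferrers_board_def)
  have None: "case_nat None \<phi> \<in> rook_placements s (c # B) k \<longleftrightarrow> \<phi> \<in> rook_placements s B k" for \<phi>
    unfolding case_nat_in_rook_placements using rook_placements_columns(2) by auto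
  have Some: "case_nat (Some r) \<phi> \<in> rook_placements s (c # B) k \<longleftrightarrow> (\<phi>, r) \<in> P" for r \<phi>
    unfolding case_nat_in_rook_placements P_def F_def
    using rook_placements_columns(2) by (auto split: nat.splits)
  have un: "rook_placements s (c # B) k = case_nat None ` rook_placements s B k \<union> f ` P"
  proof (intro equalityI subsetI)
    fix \<psi> assume \<psi>: "\<psi> \<in> rook_placements s (c # B) k"
    show "\<psi> \<in> case_nat None ` rook_placements s B k \<union> f ` P"
    proof (cases "\<psi> 0")
      case None
      then have "\<psi> = case_nat None (\<lambda>i. \<psi> (Suc i))"
        using case_nat_0_Suc[of \<psi>] by simp
      with \<psi> \<open>\<And>\<phi>. case_nat None \<phi> \<in> _ \<longleftrightarrow> _\<close> show ?thesis by (metis UnI1 imageI)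
    next
      case (Some r)
      then have "\<psi> = case_nat (Some r) (\<lambda>i. \<psi> (Suc i))"
        using case_nat_0_Suc[of \<psi>] by simp
      with \<psi> \<open>\<And>r \<phi>. case_nat (Some r) \<phi> \<in> _ \<longleftrightarrow> _\<close> have "\<psi> = f (\<lambda>i. \<psi> (Suc i), r)"
        "(\<lambda>i. \<psi> (Suc i), r) \<in> P"
        by (metis f_def prod.case)+
      then show ?thesis by blast
    qed
  qed (auto simp: None Some f_def)
  have inj: "\<phi> = \<phi>' \<and> x = x'" if "case_nat x \<phi> = (case_nat x' \<phi>' :: rooks)" for x x' \<phi> \<phi>'
    using fun_cong[OF that, of 0] fun_cong[OF that, of "Suc _"] by auto
  have inj_None: "inj_on (case_nat None) (rook_placements s B k)"
    by (auto intro!: inj_onI dest: inj)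
  have inj_f: "inj_on f P"
    by (auto intro!: inj_onI simp: f_def dest: inj)
  have finP: "finite P"
    by (auto simp: P_def F_def finite_rook_placements split: nat.splits)
  have weight: "rook_weight s h p q (c # B) (case_nat x \<phi>) = rook_weight s h p q B \<phi> *
    (case x of
       None \<Rightarrow> p ^ b * q ^ (c + s * b - b)
     | Some r \<Rightarrow> h * p ^ card {r' \<in> F b \<phi>. r' < r} * q ^ card {r' \<in> F b \<phi>. r < r'})"
    if "\<phi> \<in> rook_placements s B b" "set_option x \<subseteq> F b \<phi>" for x \<phi> b
    using that rook_weight_case_nat[OF rook_placements_columns(1)[OF that(1)], where x = x and s = s and c = c]
      rook_placements_columns(2)[OF that(1)] rook_rows_placement[OF that(1) B c]
    by (simp add: F_def card_Diff_subset cong: option.case_cong)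
  have card_F: "card (F b \<phi>) = c + s * b - b" "finite (F b \<phi>)" if "\<phi> \<in> rook_placements s B b" for b \<phi>
    using rook_rows_placement[OF that B c] by (simp_all add: F_def card_Diff_subset)
  have "rook_number s h p q (c # B) k =
      (\<Sum>\<phi>\<in>rook_placements s B k. rook_weight s h p q (c # B) (case_nat None \<phi>)) +
      (\<Sum>z\<in>P. rook_weight s h p q (c # B) (f z))"
  proof -
    have "case_nat None ` rook_placements s B k \<inter> f ` P = {}"
      by (auto simp: f_def dest: inj)
    then show ?thesis
      unfolding rook_number_def un
      by (simp add: sum.union_disjoint finP finite_rook_placements
          sum.reindex[OF inj_None] sum.reindex[OF inj_f])
  qed
  also have "(\<Sum>\<phi>\<in>rook_placements s B k. rook_weight s h p q (c # B) (case_nat None \<phi>)) =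
      p ^ k * q ^ (c + s * k - k) * rook_number s h p q B k"
    by (simp add: weight rook_number_def sum_distrib_left mult_ac)
  also have "(\<Sum>z\<in>P. rook_weight s h p q (c # B) (f z)) =
     (case k of 0 \<Rightarrow> 0 | Suc b \<Rightarrow> h * twin_basic p q (c + s * b - b) * rook_number s h p q B b)"
  proof (cases k)
    case 0
    then show ?thesis by (simp add: P_def)
  next
    case (Suc b)
    have "(\<Sum>z\<in>P. rook_weight s h p q (c # B) (f z)) =
        (\<Sum>\<phi>\<in>rook_placements s B b. \<Sum>r\<in>F b \<phi>. rook_weight s h p q (c # B) (case_nat (Some r) \<phi>))"
      using Suc card_F(2) by (simp add: P_def f_def sum.Sigma finite_rook_placements case_prod_beta)
    also have "\<dots> = (\<Sum>\<phi>\<in>rook_placements s B b. rook_weight s h p q B \<phi> * (h *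
        (\<Sum>r\<in>F b \<phi>. p ^ card {r' \<in> F b \<phi>. r' < r} * q ^ card {r' \<in> F b \<phi>. r < r'})))"
      by (intro sum.cong refl) (simp add: weight sum_distrib_left mult.assoc)
    \<comment> \<open>By \<open>sum_twin_basic\<close> the inner sum depends on
      \<open>\<phi>\<close> only through the number of free rows, which is the same for all
      placements of \<open>b\<close> rooks.\<close>
    also have "\<dots> = h * twin_basic p q (c + s * b - b) * rook_number s h p q B b"
      by (simp add: sum_twin_basic card_F rook_number_def sum_distrib_left mult_ac)
    finally show ?thesis using Suc by simp
  qed
  finally show ?thesis .
qed

section \<open>Staircase boards and Stirling numbers\<close>

lemma rook_number_Nil: "rook_number s h p q [] k = (if k = 0 then 1 else 0)"
proof -
  have "\<phi> \<in> rook_placements s [] k \<longleftrightarrow> \<phi> = (\<lambda>_. None) \<and> k = 0" for \<phi>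
    by (auto simp: rook_placements_def boxes_def rook_boxes_def)
  then have "rook_placements s [] k = (if k = 0 then {\<lambda>_. None} else {})" by auto
  moreover have "boxes s [] \<phi> = {}" for \<phi> by (simp add: boxes_def)
  ultimately show ?thesis
    by (simp add: rook_number_def rook_weight_def rook_boxes_def t_boxes_def l_boxes_def e_boxes_def)
qed

text \<open>The board has only \<open>n - 1\<close> columns, each with at most one rook.\<close>

lemma rook_number_staircase_eq_0:
  assumes "k \<ge> n" "n \<ge> 1"
  shows "rook_number s h p q (staircase n) k = 0"
proof -
  have "rook_placements s (staircase n) k = {}"
  proof safe
    fix \<phi> assume "\<phi> \<in> rook_placements s (staircase n) k"
    note rook_placements_columns[OF this]
    then have "k \<le> length (staircase n)" by (metis card_lessThan card_mono finite_lessThan)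
    then show "\<phi> \<in> {}" using assms by (simp add: staircase_def)
  qed
  then show ?thesis by (simp add: rook_number_def)
qed

text \<open>An empty first column matches the first summand of the Stirling recurrence, a rook in it
  the second. The induction starts at 1 because \<open>staircase 0\<close> and
  \<open>staircase 1\<close> are both empty, so prepending a column of height \<open>n\<close> fails
  for \<open>n = 0\<close>.\<close>

lemma gen_stirling_eq_rook_number:
  assumes "n \<ge> 1"
  shows "l \<le> n \<Longrightarrow> gen_stirling s h p q n l = rook_number s h p q (staircase n) (n - l)"
  using assms
proof (induction n arbitrary: l rule: nat_induct_at_least)
  case base
  \<comment> \<open>For \<open>l = 0\<close> the Stirling number vanishes because
    \<open>twin_basic p q 0 = 0\<close>, in agreement with the empty board having no place for a
    rook.\<close>
  then show ?case
    by (cases l) (auto simp: staircase_def rook_number_Nil twin_basic_def)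
next
  case (Suc n)
  have J: "staircase (Suc n) = n # staircase n"
    using Suc.hyps by (simp add: staircase_def)
  note rec = rook_number_Cons[of n "staircase n", folded J, OF ferrers_board_staircase]
  \<comment> \<open>At the ends one summand is missing: for \<open>l = 0\<close> it corresponds to
    too many rooks on \<open>staircase n\<close>, for \<open>l = Suc n\<close> to a rook in the
    first column although no rooks are to be placed.\<close>
  consider "l = 0" | m where "l = Suc m" "m < n" | "l = Suc n"
    using Suc.prems by (cases l) (auto simp: le_less)
  then show ?case
  proof cases
    case 1
    have "rook_number s h p q (staircase n) (Suc n) = 0"
      using Suc.hyps by (intro rook_number_staircase_eq_0) auto
    with 1 Suc.IH[of 0] show ?thesis
      by (simp add: rec)
  next
    case 2
    have "n - m = Suc (n - Suc m)" using 2 by simp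
    \<comment> \<open>With \<open>n - m\<close> rooks to the right, the number of free boxes equals
      the exponent of \<open>Y\<close> in the normal ordering term with index
      \<open>m\<close>.\<close>
    have e1: "n + s * (n - m) - (n - m) = s * (n - m) + m" using 2 by simp
    have e2: "n + s * (n - Suc m) - (n - Suc m) = s * (n - Suc m) + Suc m" using 2 by simp
    have "rook_number s h p q (staircase (Suc n)) (n - m) =
        p ^ (n - m) * q ^ (s * (n - m) + m) * gen_stirling s h p q n m +
        h * twin_basic p q (s * (n - Suc m) + Suc m) * gen_stirling s h p q n (Suc m)"
      using 2 Suc.IH[of m] Suc.IH[of "Suc m"]
      by (simp add: rec e1 \<open>n - m = Suc (n - Suc m)\<close>[symmetric])
        (simp add: \<open>n - m = Suc (n - Suc m)\<close> e2)
    then show ?thesis using 2 by simp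
  next
    case 3
    with Suc.IH[of n] show ?thesis
      by (simp add: rec)
  qed
qed

theorem corollary4p16:
  fixes s n :: nat and h p q :: complex
  assumes "s \<ge> 1" and "h \<noteq> 0" and "n \<ge> 1"
  defines "A \<equiv> weyl_algebra s h p q"
    and "X \<equiv> weyl_X s h p q" and "Y \<equiv> weyl_Y s h p q" and "Z \<equiv> weyl_Z s h p q"
  shows "(Y \<otimes>\<^bsub>A\<^esub> X) [^]\<^bsub>A\<^esub> n =
           (\<Oplus>\<^bsub>A\<^esub>l\<in>{0..n}. weyl_scale s h p q (rook_number s h p q (staircase n) (n - l))
              (Y [^]\<^bsub>A\<^esub> (s * (n - l) + l) \<otimes>\<^bsub>A\<^esub> Z [^]\<^bsub>A\<^esub> (n - l) \<otimes>\<^bsub>A\<^esub> X [^]\<^bsub>A\<^esub> l))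
         \<and> (\<forall>l\<le>n. gen_stirling s h p q n l = rook_number s h p q (staircase n) (n - l))"
proof -
  have stirling: "gen_stirling s h p q n l = rook_number s h p q (staircase n) (n - l)" if "l \<le> n" for l
    using gen_stirling_eq_rook_number assms(3) that by blast
  \<comment> \<open>The identity is transported from representatives in the free algebra by the
    quotient homomorphism.\<close>
  have "(Y \<otimes>\<^bsub>A\<^esub> X) [^]\<^bsub>A\<^esub> n = weyl_class s h p q ((free_gen GenY * free_gen GenX) ^ n)"
    by (simp add: A_def X_def Y_def weyl_X_def weyl_Y_def weyl_class_mult weyl_class_power)
  also have "\<dots> = weyl_class s h p q (\<Sum>l\<in>{0..n}. free_const (rook_number s h p q (staircase n) (n - l)) *
      (free_gen GenY ^ (s * (n - l) + l) * free_gen GenZ ^ (n - l) * free_gen GenX ^ l))"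
    unfolding weyl_class_normal_ordering[OF assms(1)] atMost_atLeast0
    by (intro arg_cong[of _ _ "weyl_class s h p q"] sum.cong) (simp_all add: stirling)
  also have "\<dots> = (\<Oplus>\<^bsub>A\<^esub>l\<in>{0..n}. weyl_scale s h p q (rook_number s h p q (staircase n) (n - l))
      (Y [^]\<^bsub>A\<^esub> (s * (n - l) + l) \<otimes>\<^bsub>A\<^esub> Z [^]\<^bsub>A\<^esub> (n - l) \<otimes>\<^bsub>A\<^esub> X [^]\<^bsub>A\<^esub> l))"
    by (simp add: weyl_class_sum weyl_class_mult weyl_class_power A_def X_def Y_def Z_def
        weyl_X_def weyl_Y_def weyl_Z_def weyl_scale_def)
  finally show ?thesis
    using stirling by blast
qed

end
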